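(* Let $\bm z^{(j)}\in\mathbb{C}^{n^2}$ be the $j$-th iterate, and let $\Phi$ and $\widetilde\Phi(\cdot;\bm z^{(j)})$ be the objective and its quadratic surrogate defined in the context. The quadratic surrogate, as an approximation to the original objective $\Phi$, has the following properties: (1) $\Phi$ and $\widetilde\Phi(\cdot;\bm z^{(j)})$ agree at $\bm z^{(j)}$: $\Phi(\bm z^{(j)})=\widetilde\Phi(\bm z^{(j)};\bm z^{(j)})$; (2) $\Phi$ is dominated by $\widetilde\Phi(\cdot;\bm z^{(j)})$: $\Phi(\bm z)\le\widetilde\Phi(\bm z;\bm z^{(j)})$ for all $\bm z\in\mathbb{C}^{n^2}$; (3) the complex gradients of $\Phi$ and $\widetilde\Phi(\cdot;\bm z^{(j)})$ agree at $\bm z^{(j)}$: $\nabla_{\bm z}\Phi(\bm z^{(j)})=\nabla_{\bm z}\widetilde\Phi(\bm z^{(j)};\bm z^{(j)})$, where on the right the gradient is taken with respect to the first argument.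
   Context: Setting. $n,m,N$ are positive integers; $\bm Q\in\mathbb{C}^{m^2}$ (the probe); for $k=1,\dots,N$, $P_k\in\mathbb{R}^{m^2\times n^2}$ is the matrix that extracts the $k$-th scanning region (a selection of $m^2$ of the $n^2$ entries), and $\bm d_k\in\mathbb{R}^{m^2}$ is a vector of measured intensities (nonnegative entries). $\mathcal F$ is the two-dimensional discrete Fourier transform on vectorized $m\times m$ arrays, normalized so that $\|\mathcal F\bm v\|_2^2=m^2\|\bm v\|_2^2$. $\odot$ is the entrywise product; $|\cdot|$, $\sqrt{\cdot}$, $\exp$ and the principal argument $\theta$ act entrywise. Write $\bm z_k=P_k\bm z$ and $\bm z_k^{(j)}=P_k\bm z^{(j)}$, where $\bm z^{(j)}$, $j=0,1,\dots$, are the iterates of an optimizer. Revised exit wave: $\mathcal R_k(\bm z_k)=\mathcal F^{-1}\big(\sqrt{\bm d_k}\odot\exp(i\theta(\mathcal F(\bm Q\odot\bm z_k)))\big)$. Convention for $\theta$ at zeros in $\mathcal R_k$: if $[\mathcal F(\bm Q\odot\bm z_k)]_r=0$, then $[\theta(\mathcal F(\bm Q\odot\bm z_k))]_r$ is set to $0$ for a general point $\bm z$; for an iterate $\bm z^{(j)}$ with $[\mathcal F(\bm Q\odot\bm z_k^{(j)})]_r=0$ it is set to $0$ if $j=0$, and to $[\theta(\mathcal F(\bm Q\odot\bm z_k^{(j-1)}))]_r$ if $j\ge1$. Objective: $\Phi(\bm z)=\frac12\sum_{k=1}^N\|\bm Q\odot P_k\bm z-\mathcal R_k(P_k\bm z)\|_2^2$.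 Surrogate: $\widetilde\Phi(\bm z;\bm z^{(j)})=\frac12\sum_{k=1}^N\|\bm Q\odot P_k\bm z-\mathcal R_k(P_k\bm z^{(j)})\|_2^2$. Complex gradient: for real-valued $f$ of $\bm z=\bm x+i\bm y$ ($\bm x,\bm y$ real), $\nabla_{\bm z}f=\nabla_{\bm x}f+i\nabla_{\bm y}f$.
   Formalization: Property (3) is stated for iterates at which all partial derivatives of Φ exist, since Φ can fail to have a gradient (n=m=N=1, Q=1, d=1, z^(j)=0); they are shown to exist if no entry of F(Q⊙z_k^(j)) vanishes where d_k is nonzero. *)

theory Defs
  imports "HOL-Analysis.Analysis" "Jordan_Normal_Form.Matrix"
begin

text \<open>
  Vectors and matrices are those of \<^theory>\<open>Jordan_Normal_Form.Matrix\<close>, so that sizes such as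
  \<open>m\<^sup>2\<close> are ordinary numbers. Their entries are indexed from \<open>0\<close>.
\<close>

unbundle no vec_syntax
hide_const (open) Finite_Cartesian_Product.vec Finite_Cartesian_Product.mat

abbreviation entrywise_mult :: "'a :: semiring_0 vec \<Rightarrow> 'a vec \<Rightarrow> 'a vec" (infixl "\<odot>" 70)
  where "v \<odot> w \<equiv> component_mult v w"

definition vec_norm2 :: "complex vec \<Rightarrow> real"
  where "vec_norm2 v = L2_set (\<lambda>i. cmod (v $ i)) {..<dim_vec v}"


subsection \<open>The two-dimensional discrete Fourier transform\<close>

text \<open>
  Index \<open>a < m\<^sup>2\<close> of a vectorized \<open>m \<times> m\<close> array stands for the position \<open>(a div m, a mod m)\<close>.
  Row-major and column-major vectorization give the same transform, since the kernel is invariant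
  under exchanging the two coordinates of both of its arguments.
\<close>

definition dft2_kernel :: "nat \<Rightarrow> nat \<Rightarrow> nat \<Rightarrow> complex"
  where "dft2_kernel m a b =
    cis (- 2 * pi * real ((a div m) * (b div m) + (a mod m) * (b mod m)) / real m)"

definition dft2 :: "nat \<Rightarrow> complex vec \<Rightarrow> complex vec"
  where "dft2 m v = vec (m^2) (\<lambda>b. \<Sum>a<m^2. dft2_kernel m a b * v $ a)"

definition idft2 :: "nat \<Rightarrow> complex vec \<Rightarrow> complex vec"
  where "idft2 m v =
    vec (m^2) (\<lambda>a. (\<Sum>b<m^2. cnj (dft2_kernel m a b) * v $ b) / of_nat (m^2))"

lemma dft2_kernel_sym: "dft2_kernel m a b = dft2_kernel m b a"
  by (simp add: dft2_kernel_def mult.commute)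

lemma sum_square_index:
  fixes f :: "nat \<Rightarrow> nat \<Rightarrow> 'a :: comm_monoid_add"
  assumes "0 < m"
  shows "(\<Sum>b<m^2. f (b div m) (b mod m)) = (\<Sum>p<m. \<Sum>q<m. f p q)"
proof -
  have "(\<Sum>b<m^2. f (b div m) (b mod m)) = (\<Sum>(p, q)\<in>{..<m} \<times> {..<m}. f p q)"
  proof (rule sum.reindex_bij_witness[where i = "\<lambda>(p, q). p * m + q"
        and j = "\<lambda>b. (b div m, b mod m)"], goal_cases)
    case (2 b)
    then show ?case
      using assms by (auto simp: power2_eq_square less_mult_imp_div_less)
  next
    case (4 b)
    then obtain p q where b: "b = (p, q)" "p < m" "q < m" by auto
    have "p * m + q < Suc p * m" using b by simp
    also have "\<dots> \<le> m * m" using b by (intro mult_le_mono1) simp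
    finally show ?case using b by (simp add: power2_eq_square)
  qed (use assms in auto)
  then show ?thesis by (simp add: sum.cartesian_product)
qed

lemma sum_cis_orthogonal:
  assumes "p < m" "q < m"
  shows "(\<Sum>k<m. cis (2 * pi * (real p - real q) * real k / real m)) = (if p = q then of_nat m else 0)"
proof (cases "p = q")
  case False
  define w where "w = cis (2 * pi * (real p - real q) / real m)"
  have m: "0 < m" using assms by simp
  have pow: "cis (2 * pi * (real p - real q) * real k / real m) = w ^ k" for k
    unfolding w_def Complex.DeMoivre by (rule arg_cong[where f = cis]) (simp add: field_simps)
  have "w ^ m = cis (2 * pi * of_int (int p - int q))"
    using m by (simp add: w_def Complex.DeMoivre)
  then have wm: "w ^ m = 1"
    by (simp add: cis_multiple_2pi del: of_int_diff)
  have "w \<noteq> 1"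
  proof
    assume "w = 1"
    then have "cos (2 * pi * (real p - real q) / real m) = 1"
      by (simp add: w_def complex_eq_iff)
    then obtain x :: int where "2 * pi * (real p - real q) / real m = of_int x * 2 * pi"
      using cos_one_2pi_int by blast
    then have "(2 * pi) * (real p - real q) = (2 * pi) * (of_int x * real m)"
      using m by (simp add: divide_eq_eq mult_ac)
    then have "real p - real q = of_int x * real m"
      by (simp only: mult_cancel_left) simp
    then have "real_of_int (int p - int q) = real_of_int (x * int m)"
      by simp
    then have eq: "int p - int q = x * int m"
      using of_int_eq_iff by blast
    then have "x \<noteq> 0" using False by auto
    then have "int m \<le> \<bar>x * int m\<bar>"
      by (cases m) (auto simp: abs_mult mult_le_cancel_right1)
    then show False using eq assms by linarith
  qed
  then have "(\<Sum>k<m. w ^ k) = 0"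
    using wm by (simp add: sum_gp_strict)
  then show ?thesis using False pow by simp
qed simp

lemma dft2_kernel_orthogonal:
  assumes "a < m^2" "a' < m^2"
  shows "(\<Sum>b<m^2. cnj (dft2_kernel m a b) * dft2_kernel m a' b) = (if a = a' then of_nat (m^2) else 0)"
proof -
  have m: "0 < m" using assms by (cases m) auto
  define c where "c = (\<lambda>p q k. cis (2 * pi * (real p - real q) * real k / real m))"
  have "cnj (dft2_kernel m a b) * dft2_kernel m a' b
      = c (a div m) (a' div m) (b div m) * c (a mod m) (a' mod m) (b mod m)" for b
    unfolding dft2_kernel_def c_def cis_cnj cis_mult
    by (rule arg_cong[where f = cis]) (use m in \<open>simp add: field_simps\<close>)
  then have "(\<Sum>b<m^2. cnj (dft2_kernel m a b) * dft2_kernel m a' b)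
      = (\<Sum>p<m. \<Sum>q<m. c (a div m) (a' div m) p * c (a mod m) (a' mod m) q)"
    using sum_square_index[OF m,
      of "\<lambda>p q. c (a div m) (a' div m) p * c (a mod m) (a' mod m) q"] by simp
  also have "\<dots> = (\<Sum>p<m. c (a div m) (a' div m) p) * (\<Sum>q<m. c (a mod m) (a' mod m) q)"
    by (simp add: sum_product)
  also have "\<dots> = (if a div m = a' div m then of_nat m else 0) * (if a mod m = a' mod m then of_nat m else 0)"
    using assms m unfolding c_def
    by (subst (1 2) sum_cis_orthogonal)
      (auto simp: power2_eq_square less_mult_imp_div_less)
  also have "\<dots> = (if a = a' then of_nat (m^2) else 0)"
    by (auto simp: power2_eq_square) (metis div_mult_mod_eq)
  finally show ?thesis .
qed

lemma idft2_dft2: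
  assumes "v \<in> carrier_vec (m^2)"
  shows "idft2 m (dft2 m v) = v"
proof (rule eq_vecI)
  show dim: "dim_vec (idft2 m (dft2 m v)) = dim_vec v"
    using assms by (simp add: idft2_def)
  fix a assume "a < dim_vec v"
  then have a: "a < m^2" using assms by simp
  have "(\<Sum>b<m^2. cnj (dft2_kernel m a b) * dft2 m v $ b)
      = (\<Sum>b<m^2. \<Sum>a'<m^2. cnj (dft2_kernel m a b) * dft2_kernel m a' b * v $ a')"
    by (simp add: dft2_def sum_distrib_left mult.assoc)
  also have "\<dots> = (\<Sum>a'<m^2. (\<Sum>b<m^2. cnj (dft2_kernel m a b) * dft2_kernel m a' b) * v $ a')"
    by (subst sum.swap) (simp add: sum_distrib_right)
  also have "\<dots> = (\<Sum>a'<m^2. if a' = a then of_nat (m^2) * v $ a' else 0)"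
    using a by (intro sum.cong) (auto simp: dft2_kernel_orthogonal)
  also have "\<dots> = of_nat (m^2) * v $ a"
    using a by simp
  finally show "idft2 m (dft2 m v) $ a = v $ a"
    using a by (auto simp: idft2_def)
qed

lemma dft2_idft2:
  assumes "v \<in> carrier_vec (m^2)"
  shows "dft2 m (idft2 m v) = v"
proof (rule eq_vecI)
  show dim: "dim_vec (dft2 m (idft2 m v)) = dim_vec v"
    using assms by (simp add: dft2_def)
  fix b assume "b < dim_vec v"
  then have b: "b < m^2" using assms by simp
  have "dft2_kernel m a b * (\<Sum>b'<m^2. cnj (dft2_kernel m a b') * v $ b')
      = (\<Sum>b'<m^2. cnj (dft2_kernel m b' a) * dft2_kernel m b a * v $ b')" for a
    by (simp add: sum_distrib_left mult_ac dft2_kernel_sym[of m a])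
  then have "(\<Sum>a<m^2. dft2_kernel m a b * idft2 m v $ a)
      = (\<Sum>a<m^2. \<Sum>b'<m^2. cnj (dft2_kernel m b' a) * dft2_kernel m b a * v $ b' / of_nat (m^2))"
    by (simp add: idft2_def flip: sum_divide_distrib)
  also have "\<dots> = (\<Sum>b'<m^2. (\<Sum>a<m^2. cnj (dft2_kernel m b' a) * dft2_kernel m b a) * v $ b' / of_nat (m^2))"
    by (subst sum.swap) (simp add: sum_distrib_right sum_divide_distrib)
  also have "\<dots> = (\<Sum>b'<m^2. if b' = b then v $ b' else 0)"
    using b by (intro sum.cong) (auto simp: dft2_kernel_orthogonal)
  also have "\<dots> = v $ b"
    using b by simp
  finally show "dft2 m (idft2 m v) $ b = v $ b"
    using b by (simp add: dft2_def)
qed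

lemma vec_norm2_dft2:
  assumes "v \<in> carrier_vec (m^2)"
  shows "(vec_norm2 (dft2 m v))^2 = real (m^2) * (vec_norm2 v)^2"
proof -
  have "complex_of_real ((vec_norm2 (dft2 m v))^2)
      = (\<Sum>b<m^2. cnj (dft2 m v $ b) * dft2 m v $ b)"
    by (simp add: vec_norm2_def L2_set_def sum_nonneg dft2_def complex_norm_square mult.commute
        del: of_real_power)
  also have "\<dots> = (\<Sum>b<m^2. \<Sum>a<m^2. \<Sum>a'<m^2.
      cnj (dft2_kernel m a b) * dft2_kernel m a' b * (cnj (v $ a) * v $ a'))"
  proof (intro sum.cong refl)
    fix b assume "b \<in> {..<m^2}"
    then have "cnj (dft2 m v $ b) * dft2 m v $ b
        = (\<Sum>a<m^2. cnj (dft2_kernel m a b * v $ a)) * (\<Sum>a'<m^2. dft2_kernel m a' b * v $ a')"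
      by (simp add: dft2_def)
    also have "\<dots> = (\<Sum>a<m^2. \<Sum>a'<m^2.
        cnj (dft2_kernel m a b * v $ a) * (dft2_kernel m a' b * v $ a'))"
      by (rule sum_product)
    finally show "cnj (dft2 m v $ b) * dft2 m v $ b = (\<Sum>a<m^2. \<Sum>a'<m^2.
        cnj (dft2_kernel m a b) * dft2_kernel m a' b * (cnj (v $ a) * v $ a'))"
      by (simp add: mult_ac)
  qed
  also have "\<dots> = (\<Sum>a<m^2. \<Sum>b<m^2. \<Sum>a'<m^2.
      cnj (dft2_kernel m a b) * dft2_kernel m a' b * (cnj (v $ a) * v $ a'))"
    by (rule sum.swap)
  also have "\<dots> = (\<Sum>a<m^2. \<Sum>a'<m^2. \<Sum>b<m^2.
      cnj (dft2_kernel m a b) * dft2_kernel m a' b * (cnj (v $ a) * v $ a'))"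
    by (intro sum.cong refl sum.swap)
  also have "\<dots> = (\<Sum>a<m^2. \<Sum>a'<m^2.
      (\<Sum>b<m^2. cnj (dft2_kernel m a b) * dft2_kernel m a' b) * (cnj (v $ a) * v $ a'))"
    by (simp only: sum_distrib_right)
  also have "\<dots> = (\<Sum>a<m^2. \<Sum>a'<m^2. if a' = a then of_nat (m^2) * (cnj (v $ a) * v $ a') else 0)"
    by (intro sum.cong refl) (auto simp: dft2_kernel_orthogonal)
  also have "\<dots> = (\<Sum>a<m^2. of_nat (m^2) * (cnj (v $ a) * v $ a))"
    by simp
  also have "\<dots> = complex_of_real (real (m^2) * (vec_norm2 v)^2)"
    using assms
    by (simp add: vec_norm2_def L2_set_def sum_nonneg complex_norm_square mult.commute
        sum_distrib_left of_nat_power del: of_real_power) (simp add: power2_eq_square)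
  finally show ?thesis
    using of_real_eq_iff by blast
qed


subsection \<open>Scanning regions, exit waves, objective and surrogate\<close>

definition selection_matrix :: "nat \<Rightarrow> nat \<Rightarrow> real mat \<Rightarrow> bool"
  where "selection_matrix r c S \<longleftrightarrow> S \<in> carrier_mat r c \<and>
    (\<exists>s. inj_on s {..<r} \<and> s ` {..<r} \<subseteq> {..<c} \<and>
      (\<forall>i<r. \<forall>l<c. S $$ (i, l) = (if l = s i then 1 else 0)))"

abbreviation region :: "real mat \<Rightarrow> complex vec \<Rightarrow> complex vec"
  where "region S z \<equiv> map_mat complex_of_real S *\<^sub>v z"

text \<open>
  In the following, \<open>w\<close> is a vector in \<open>\<complex>\<^bsup>m\<^sup>2\<^esup>\<close> (a region \<open>z\<^sub>k\<close>), and \<open>ws\<close> is a sequence of such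
  vectors (the regions \<open>z\<^sub>k\<^bsup>(0)\<^esup>, z\<^sub>k\<^bsup>(1)\<^esup>, \<dots>\<close> of the iterates). For a general point the
  phase of a vanishing entry is \<open>0\<close>; this is built into \<^const>\<open>Arg\<close>, as \<open>Arg 0 = 0\<close>.
\<close>

definition phase :: "nat \<Rightarrow> complex vec \<Rightarrow> complex vec \<Rightarrow> real vec"
  where "phase m Q w = map_vec Arg (dft2 m (Q \<odot> w))"

text \<open>
  For an iterate, a vanishing entry inherits the phase of the previous iterate, which may in turn
  have been inherited.
\<close>

primrec iterate_phase ::
    "nat \<Rightarrow> complex vec \<Rightarrow> (nat \<Rightarrow> complex vec) \<Rightarrow> nat \<Rightarrow> real vec"
  where
    "iterate_phase m Q ws 0 = phase m Q (ws 0)"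
  | "iterate_phase m Q ws (Suc j) = vec (m^2) (\<lambda>r.
      if dft2 m (Q \<odot> ws (Suc j)) $ r = 0 then iterate_phase m Q ws j $ r
      else phase m Q (ws (Suc j)) $ r)"

definition wave_of_phase :: "nat \<Rightarrow> real vec \<Rightarrow> real vec \<Rightarrow> complex vec"
  where "wave_of_phase m d \<theta> =
    idft2 m (map_vec (\<lambda>x. complex_of_real (sqrt x)) d \<odot> map_vec (\<lambda>t. exp (\<i> * complex_of_real t)) \<theta>)"

definition revised_wave :: "nat \<Rightarrow> complex vec \<Rightarrow> real vec \<Rightarrow> complex vec \<Rightarrow> complex vec"
  where "revised_wave m Q d w = wave_of_phase m d (phase m Q w)"

definition iterate_revised_wave ::
    "nat \<Rightarrow> complex vec \<Rightarrow> real vec \<Rightarrow> (nat \<Rightarrow> complex vec) \<Rightarrow> nat \<Rightarrow> complex vec"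
  where "iterate_revised_wave m Q d ws j = wave_of_phase m d (iterate_phase m Q ws j)"

definition objective ::
    "nat \<Rightarrow> nat \<Rightarrow> complex vec \<Rightarrow> (nat \<Rightarrow> real mat) \<Rightarrow> (nat \<Rightarrow> real vec) \<Rightarrow> complex vec \<Rightarrow> real"
  where "objective m N Q P d z =
    1 / 2 * (\<Sum>k = 1..N.
      (vec_norm2 (Q \<odot> region (P k) z - revised_wave m Q (d k) (region (P k) z)))^2)"

definition surrogate ::
    "nat \<Rightarrow> nat \<Rightarrow> complex vec \<Rightarrow> (nat \<Rightarrow> real mat) \<Rightarrow> (nat \<Rightarrow> real vec) \<Rightarrow>
      (nat \<Rightarrow> complex vec) \<Rightarrow> nat \<Rightarrow> complex vec \<Rightarrow> real"
  where "surrogate m N Q P d zs j z =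
    1 / 2 * (\<Sum>k = 1..N.
      (vec_norm2 (Q \<odot> region (P k) z
        - iterate_revised_wave m Q (d k) (\<lambda>i. region (P k) (zs i)) j))^2)"


subsection \<open>The complex gradient\<close>

text \<open>
  \<open>along f z a c\<close> is \<open>f\<close> restricted to the line through \<open>z\<close> in coordinate \<open>a\<close>, in the real direction
  for \<open>c = 1\<close> and in the imaginary direction for \<open>c = \<i>\<close>.
\<close>

definition along :: "(complex vec \<Rightarrow> real) \<Rightarrow> complex vec \<Rightarrow> nat \<Rightarrow> complex \<Rightarrow> real \<Rightarrow> real"
  where "along f z a c t = f (z + (complex_of_real t * c) \<cdot>\<^sub>v unit_vec (dim_vec z) a)"

definition grad_re :: "(complex vec \<Rightarrow> real) \<Rightarrow> complex vec \<Rightarrow> real vec"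
  where "grad_re f z = vec (dim_vec z) (\<lambda>a. deriv (along f z a 1) 0)"

definition grad_im :: "(complex vec \<Rightarrow> real) \<Rightarrow> complex vec \<Rightarrow> real vec"
  where "grad_im f z = vec (dim_vec z) (\<lambda>a. deriv (along f z a \<i>) 0)"

definition complex_gradient :: "(complex vec \<Rightarrow> real) \<Rightarrow> complex vec \<Rightarrow> complex vec"
  where "complex_gradient f z =
    map_vec complex_of_real (grad_re f z) + \<i> \<cdot>\<^sub>v map_vec complex_of_real (grad_im f z)"

text \<open>\<^const>\<open>deriv\<close> is total, so the existence of the partial derivatives is stated separately.\<close>

definition complex_gradient_exists :: "(complex vec \<Rightarrow> real) \<Rightarrow> complex vec \<Rightarrow> bool"
  where "complex_gradient_exists f z \<longleftrightarrow>
    (\<forall>a<dim_vec z. along f z a 1 field_differentiable at 0 \<and> along f z a \<i> field_differentiable at 0)"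

end

theory Submission
  imports Defs
begin

text \<open>
  By Parseval's identity each squared residual is a sum over Fourier coefficients. For the measured
  modulus \<open>s = sqrt (d $ r)\<close>, the coefficient \<open>F\<close> of the exit wave at \<open>z\<close> and an assigned
  phase \<open>t\<close>, the contribution is \<open>(cmod (F - s * cis t))\<^sup>2\<close>, up to the factor \<open>1 / m\<^sup>2\<close>
  (\<open>residual_wave_of_phase\<close>). The surrogate keeps \<open>t\<close> at its value for the iterate. The objective
  uses \<open>t = Arg F\<close>, which turns the contribution into \<open>(cmod F - s)\<^sup>2\<close>, the squared distance from
  \<open>F\<close> to the circle of radius \<open>s\<close>; this is the smallest value over all \<open>t\<close>, by the reverse
  triangle inequality (\<open>cmod_minus_phase_ge\<close>). Hence the surrogate
  dominates. At the iterate itself \<open>t\<close> is \<open>Arg F\<close> unless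
  \<open>F = 0\<close>, and in the latter case every phase gives \<open>s\<^sup>2\<close>; hence the two functions agree there.

  The gradients then agree without being computed (\<open>complex_gradient_eq_of_touching\<close>):
  along every line through the iterate the gap
  between surrogate and objective has a minimum at the iterate, so its derivative vanishes if it
  exists. The surrogate is a quadratic polynomial on such a line, so it is always differentiable.
  In the objective the only obstruction is the term \<open>s * cmod F\<close> at a zero of \<open>F\<close>, and
  it disappears if \<open>s = 0\<close> or \<open>F \<noteq> 0\<close>.
\<close>

lemma dft2_carrier [simp]: "dft2 m v \<in> carrier_vec (m^2)"
  by (simp add: dft2_def)

lemma idft2_carrier [simp]: "idft2 m v \<in> carrier_vec (m^2)"
  by (simp add: idft2_def)

lemma dft2_minus:
  assumes "v \<in> carrier_vec (m^2)" "w \<in> carrier_vec (m^2)"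
  shows "dft2 m (v - w) = dft2 m v - dft2 m w"
  using assms by (intro eq_vecI) (auto simp: dft2_def algebra_simps sum_subtractf)

lemma exit_wave_carrier:
  assumes "Q \<in> carrier_vec k" "S \<in> carrier_mat k l"
  shows "Q \<odot> region S z \<in> carrier_vec k"
  using assms by (auto simp: component_mult_def)

lemma dft2_exit_wave_line:
  assumes "Q \<in> carrier_vec (m^2)" "S \<in> carrier_mat (m^2) l"
    and "z \<in> carrier_vec l" "e \<in> carrier_vec l" "r < m^2"
  shows "dft2 m (Q \<odot> region S (z + c \<cdot>\<^sub>v e)) $ r
    = dft2 m (Q \<odot> region S z) $ r + c * dft2 m (Q \<odot> region S e) $ r"
proof -
  have "(Q \<odot> region S (z + c \<cdot>\<^sub>v e)) $ a
      = (Q \<odot> region S z) $ a + c * (Q \<odot> region S e) $ a" if "a < m^2" for a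
    using assms that
    by (auto simp: component_mult_def scalar_prod_def algebra_simps sum.distrib sum_distrib_left)
  then show ?thesis
    using assms(5) by (simp add: dft2_def algebra_simps sum.distrib sum_distrib_left)
qed

text \<open>
  Parseval's identity: the Fourier coefficients of a wave of prescribed phase are known explicitly,
  so the residual is best measured on the Fourier side.
\<close>

lemma residual_wave_of_phase:
  assumes "v \<in> carrier_vec (m^2)" "d \<in> carrier_vec (m^2)" "\<theta> \<in> carrier_vec (m^2)"
  shows "(vec_norm2 (v - wave_of_phase m d \<theta>))^2
    = (\<Sum>r<m^2. (cmod (dft2 m v $ r - sqrt (d $ r) * cis (\<theta> $ r)))^2) / real (m^2)"
proof (cases "m = 0")
  case True
  then show ?thesis using assms by (simp add: vec_norm2_def wave_of_phase_def idft2_def)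
next
  case False
  let ?s = "map_vec (\<lambda>x. complex_of_real (sqrt x)) d
    \<odot> map_vec (\<lambda>t. exp (\<i> * complex_of_real t)) \<theta>"
  have s: "?s \<in> carrier_vec (m^2)"
    using assms by (auto simp: component_mult_def)
  have s_entry: "?s $ r = sqrt (d $ r) * cis (\<theta> $ r)" if "r < m^2" for r
    using assms that by (simp add: component_mult_def cis_conv_exp)
  have dft: "dft2 m (v - idft2 m ?s) = dft2 m v - ?s"
    using assms(1) s by (simp add: dft2_minus dft2_idft2)
  have "real (m^2) * (vec_norm2 (v - wave_of_phase m d \<theta>))^2 = (vec_norm2 (dft2 m v - ?s))^2"
    using assms(1) vec_norm2_dft2[of "v - idft2 m ?s" m]
    by (simp add: wave_of_phase_def dft)
  also have "\<dots> = (\<Sum>r<m^2. (cmod (dft2 m v $ r - sqrt (d $ r) * cis (\<theta> $ r)))^2)"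
    using s s_entry by (simp add: vec_norm2_def L2_set_def sum_nonneg)
  finally show ?thesis using False by (simp add: field_simps)
qed

lemma cmod_minus_phase_Arg: "(cmod (F - complex_of_real s * cis (Arg F)))^2 = (cmod F - s)^2"
proof -
  have "F - complex_of_real s * cis (Arg F) = complex_of_real (cmod F - s) * cis (Arg F)"
    using rcis_cmod_Arg[of F] by (simp add: rcis_def algebra_simps)
  then show ?thesis by (simp only: norm_mult norm_cis norm_of_real) simp
qed

text \<open>
  The sign condition makes \<open>s\<close> the modulus of \<open>s * cis t\<close>, so that this is the reverse triangle
  inequality. For negative \<open>s\<close> the comparison would be with \<open>cmod F + s\<close> instead.
\<close>

lemma cmod_minus_phase_ge:
  assumes "0 \<le> s"
  shows "(cmod F - s)^2 \<le> (cmod (F - complex_of_real s * cis t))^2"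
proof -
  have "\<bar>cmod F - s\<bar> \<le> cmod (F - complex_of_real s * cis t)"
    using norm_triangle_ineq3[of F "complex_of_real s * cis t"] assms by (simp add: norm_mult)
  then show ?thesis by (metis abs_ge_zero power_mono power2_abs)
qed

lemma phase_carrier [simp]: "phase m Q w \<in> carrier_vec (m^2)"
  by (simp add: phase_def)

lemma iterate_phase_carrier [simp]: "iterate_phase m Q ws j \<in> carrier_vec (m^2)"
  by (cases j) auto

lemma iterate_phase_eq_Arg:
  assumes "r < m^2" "dft2 m (Q \<odot> ws j) $ r \<noteq> 0"
  shows "iterate_phase m Q ws j $ r = Arg (dft2 m (Q \<odot> ws j) $ r)"
  using assms by (cases j) (auto simp: phase_def dft2_def)

lemma objective_fourier:
  assumes "Q \<in> carrier_vec (m^2)" "\<And>k. k \<in> {1..N} \<Longrightarrow> P k \<in> carrier_mat (m^2) l"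
    and "\<And>k. k \<in> {1..N} \<Longrightarrow> d k \<in> carrier_vec (m^2)"
  shows "objective m N Q P d z = 1 / 2 * (\<Sum>k = 1..N.
    (\<Sum>r<m^2. (cmod (dft2 m (Q \<odot> region (P k) z) $ r) - sqrt (d k $ r))^2) / real (m^2))"
  unfolding objective_def revised_wave_def
proof (intro arg_cong2[where f = "(*)"] sum.cong refl)
  fix k assume k: "k \<in> {1..N}"
  let ?v = "Q \<odot> region (P k) z"
  have v: "?v \<in> carrier_vec (m^2)"
    using exit_wave_carrier[OF assms(1) assms(2)[OF k]] .
  have "(cmod (dft2 m ?v $ r - sqrt (d k $ r) * cis (phase m Q (region (P k) z) $ r)))^2
      = (cmod (dft2 m ?v $ r) - sqrt (d k $ r))^2" if "r < m^2" for r
    using that by (simp add: phase_def cmod_minus_phase_Arg dft2_def)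
  then show "(vec_norm2 (?v - wave_of_phase m (d k) (phase m Q (region (P k) z))))^2
      = (\<Sum>r<m^2. (cmod (dft2 m ?v $ r) - sqrt (d k $ r))^2) / real (m^2)"
    using residual_wave_of_phase[OF v assms(3)[OF k] phase_carrier] by simp
qed

lemma surrogate_fourier:
  assumes "Q \<in> carrier_vec (m^2)" "\<And>k. k \<in> {1..N} \<Longrightarrow> P k \<in> carrier_mat (m^2) l"
    and "\<And>k. k \<in> {1..N} \<Longrightarrow> d k \<in> carrier_vec (m^2)"
  shows "surrogate m N Q P d zs j z = 1 / 2 * (\<Sum>k = 1..N.
    (\<Sum>r<m^2. (cmod (dft2 m (Q \<odot> region (P k) z) $ r
      - sqrt (d k $ r) * cis (iterate_phase m Q (\<lambda>i. region (P k) (zs i)) j $ r)))^2) / real (m^2))"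
  unfolding surrogate_def iterate_revised_wave_def
  using assms
  by (intro arg_cong2[where f = "(*)"] sum.cong refl residual_wave_of_phase exit_wave_carrier
      iterate_phase_carrier)

lemma cmod_power2_line_differentiable:
  "(\<lambda>t. (cmod (\<alpha> + complex_of_real t * \<beta>))^2) field_differentiable at 0"
proof -
  have "((\<lambda>t. (Re \<alpha> + t * Re \<beta>)^2 + (Im \<alpha> + t * Im \<beta>)^2) has_real_derivative
      2 * Re \<alpha> * Re \<beta> + 2 * Im \<alpha> * Im \<beta>) (at 0)"
    by (auto intro!: derivative_eq_intros)
  then show ?thesis
    unfolding field_differentiable_def cmod_power2 by auto
qed

lemma cmod_line_differentiable:
  assumes "\<alpha> \<noteq> 0"
  shows "(\<lambda>t. cmod (\<alpha> + complex_of_real t * \<beta>)) field_differentiable at 0"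
proof -
  obtain D where "((\<lambda>t. (cmod (\<alpha> + complex_of_real t * \<beta>))^2) has_real_derivative D) (at 0)"
    using cmod_power2_line_differentiable unfolding field_differentiable_def by blast
  then have "((\<lambda>t. sqrt ((cmod (\<alpha> + complex_of_real t * \<beta>))^2)) has_real_derivative
      inverse (sqrt ((cmod \<alpha>)^2)) / 2 * D) (at 0)"
    using assms DERIV_real_sqrt[of "(cmod \<alpha>)^2"]
    by (intro DERIV_chain2[where f = sqrt and g = "\<lambda>t. (cmod (\<alpha> + complex_of_real t * \<beta>))^2"]) auto
  then show ?thesis
    unfolding field_differentiable_def by auto
qed

text \<open>
  Expanding the square isolates \<open>s * cmod F\<close> as the only term that can fail to be differentiable.
\<close>

lemma modulus_misfit_line_differentiable:
  assumes "s = 0 \<or> \<alpha> \<noteq> 0"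
  shows "(\<lambda>t. (cmod (\<alpha> + complex_of_real t * \<beta>) - s)^2) field_differentiable at 0"
proof -
  have "(\<lambda>t. s * cmod (\<alpha> + complex_of_real t * \<beta>)) field_differentiable at 0"
    using assms
    by (cases "s = 0") (auto intro!: field_differentiable_mult cmod_line_differentiable)
  then have "(\<lambda>t. 2 * (s * cmod (\<alpha> + complex_of_real t * \<beta>))) field_differentiable at 0"
    by (rule field_differentiable_mult[OF field_differentiable_const])
  then have "(\<lambda>t. (cmod (\<alpha> + complex_of_real t * \<beta>))^2
      - 2 * (s * cmod (\<alpha> + complex_of_real t * \<beta>)) + s^2) field_differentiable at 0"
    by (intro field_differentiable_add field_differentiable_diff
        cmod_power2_line_differentiable field_differentiable_const)
  then show ?thesis
    by (simp add: power2_diff algebra_simps)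
qed

lemma complex_gradient_existsI:
  assumes "\<And>a c. a < dim_vec z \<Longrightarrow> along f z a c field_differentiable at 0"
  shows "complex_gradient_exists f z"
  using assms by (simp add: complex_gradient_exists_def)

text \<open>
  A differentiable function that touches another one from below has the same derivative at the
  point of contact, since the gap has a minimum there.
\<close>

lemma deriv_eq_of_touching:
  fixes f g :: "real \<Rightarrow> real"
  assumes "f field_differentiable at x" "g field_differentiable at x"
    and "f x = g x" "\<And>t. f t \<le> g t"
  shows "deriv f x = deriv g x"
proof -
  have "((\<lambda>t. g t - f t) has_real_derivative deriv g x - deriv f x) (at x)"
    using assms by (intro DERIV_diff field_differentiable_derivI)
  then have "deriv g x - deriv f x = 0"
    by (rule DERIV_local_min[where d = 1]) (use assms in auto)
  then show ?thesis by simp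
qed

lemma complex_gradient_eq_of_touching:
  assumes "complex_gradient_exists f z" "complex_gradient_exists g z" "z \<in> carrier_vec l"
    and "f z = g z" "\<And>w. w \<in> carrier_vec l \<Longrightarrow> f w \<le> g w"
  shows "complex_gradient f z = complex_gradient g z"
proof -
  have "z + (0 :: complex) \<cdot>\<^sub>v unit_vec l a = z" for a
    using assms(3) by (intro eq_vecI) auto
  then have touch: "along f z a c 0 = along g z a c 0" "along f z a c t \<le> along g z a c t" for a c t
    using assms by (auto simp: along_def)
  have "deriv (along f z a c) 0 = deriv (along g z a c) 0" if "a < dim_vec z" "c \<in> {1, \<i>}" for a c
    using assms(1,2) that touch
    by (intro deriv_eq_of_touching) (auto simp: complex_gradient_exists_def)
  then have "grad_re f z = grad_re g z" "grad_im f z = grad_im g z"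
    by (auto simp: grad_re_def grad_im_def)
  then show ?thesis by (simp add: complex_gradient_def)
qed

theorem proposition3p1:
  fixes n m N j :: nat
    and Q :: "complex vec"
    and P :: "nat \<Rightarrow> real mat"
    and d :: "nat \<Rightarrow> real vec"
    and zs :: "nat \<Rightarrow> complex vec"
  assumes "0 < n" and "0 < m" and "0 < N"
    and "Q \<in> carrier_vec (m^2)"
    and "\<forall>k\<in>{1..N}. selection_matrix (m^2) (n^2) (P k)"
    and "\<forall>k\<in>{1..N}. d k \<in> carrier_vec (m^2) \<and> (\<forall>r<m^2. 0 \<le> d k $ r)"
    and "\<forall>i. zs i \<in> carrier_vec (n^2)"
  shows
    "objective m N Q P d (zs j) = surrogate m N Q P d zs j (zs j)
     \<and> (\<forall>z\<in>carrier_vec (n^2). objective m N Q P d z \<le> surrogate m N Q P d zs j z)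
     \<and> complex_gradient_exists (surrogate m N Q P d zs j) (zs j)
     \<and> (complex_gradient_exists (objective m N Q P d) (zs j) \<longrightarrow>
          complex_gradient (objective m N Q P d) (zs j)
            = complex_gradient (surrogate m N Q P d zs j) (zs j))
     \<and> ((\<forall>k\<in>{1..N}. \<forall>r<m^2. d k $ r \<noteq> 0 \<longrightarrow> dft2 m (Q \<odot> region (P k) (zs j)) $ r \<noteq> 0) \<longrightarrow>
          complex_gradient_exists (objective m N Q P d) (zs j))"
proof -
  define F where "F k r z = dft2 m (Q \<odot> region (P k) z) $ r" for k r z
  define s where "s k r = sqrt (d k $ r)" for k r
  define \<theta> where "\<theta> k r = iterate_phase m Q (\<lambda>i. region (P k) (zs i)) j $ r" for k r
  have P: "P k \<in> carrier_mat (m^2) (n^2)" and d: "d k \<in> carrier_vec (m^2)" if "k \<in> {1..N}" for k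
    using assms that by (auto simp: selection_matrix_def)
  have zj: "zs j \<in> carrier_vec (n^2)" using assms by blast
  have obj: "objective m N Q P d z
      = 1 / 2 * (\<Sum>k = 1..N. (\<Sum>r<m^2. (cmod (F k r z) - s k r)^2) / real (m^2))" for z
    unfolding F_def s_def by (rule objective_fourier[OF assms(4) P d])
  have sur: "surrogate m N Q P d zs j z = 1 / 2 * (\<Sum>k = 1..N.
      (\<Sum>r<m^2. (cmod (F k r z - s k r * cis (\<theta> k r)))^2) / real (m^2))" for z
    unfolding F_def s_def \<theta>_def by (rule surrogate_fourier[OF assms(4) P d])
  have line: "F k r (zs j + (complex_of_real t * c) \<cdot>\<^sub>v unit_vec (dim_vec (zs j)) a)
      = F k r (zs j) + complex_of_real t * (c * F k r (unit_vec (n^2) a))"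
    if "k \<in> {1..N}" "r < m^2" for k r t c a
    unfolding F_def using assms(4) P[OF that(1)] zj that(2)
    by (subst dft2_exit_wave_line) auto

  have agree: "objective m N Q P d (zs j) = surrogate m N Q P d zs j (zs j)"
  proof -
    have "(cmod (F k r (zs j)) - s k r)^2 = (cmod (F k r (zs j) - s k r * cis (\<theta> k r)))^2"
      if "r < m^2" for k r
    proof (cases "F k r (zs j) = 0")
      case True
      then show ?thesis by (simp add: norm_mult)
    next
      case False
      then have "\<theta> k r = Arg (F k r (zs j))"
        using that by (simp add: F_def \<theta>_def iterate_phase_eq_Arg)
      then show ?thesis by (simp add: cmod_minus_phase_Arg)
    qed
    then show ?thesis by (simp add: obj sur)
  qed

  have dominated: "objective m N Q P d z \<le> surrogate m N Q P d zs j z" for z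
  proof -
    have "0 \<le> s k r" if "k \<in> {1..N}" "r < m^2" for k r
      using assms that by (simp add: s_def)
    then show ?thesis
      unfolding obj sur
      by (intro mult_left_mono sum_mono divide_right_mono cmod_minus_phase_ge) auto
  qed

  have sur_diff: "complex_gradient_exists (surrogate m N Q P d zs j) (zs j)"
  proof (rule complex_gradient_existsI)
    fix a c
    have "along (surrogate m N Q P d zs j) (zs j) a c
      = (\<lambda>t. 1 / 2 * (\<Sum>k = 1..N. (\<Sum>r<m^2. (cmod ((F k r (zs j) - s k r * cis (\<theta> k r))
          + complex_of_real t * (c * F k r (unit_vec (n^2) a))))^2) / real (m^2)))"
      unfolding along_def sur
      by (intro ext arg_cong2[where f = "(*)"] arg_cong2[where f = "(/)"] sum.cong refl)
        (simp add: line diff_add_eq)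
    then show "along (surrogate m N Q P d zs j) (zs j) a c field_differentiable at 0"
      by (simp only: divide_inverse)
        (intro field_differentiable_mult field_differentiable_sum
          cmod_power2_line_differentiable field_differentiable_const)
  qed

  have obj_diff: "complex_gradient_exists (objective m N Q P d) (zs j)"
    if nz: "\<forall>k\<in>{1..N}. \<forall>r<m^2. d k $ r \<noteq> 0 \<longrightarrow> dft2 m (Q \<odot> region (P k) (zs j)) $ r \<noteq> 0"
  proof (rule complex_gradient_existsI)
    fix a c
    have "along (objective m N Q P d) (zs j) a c
      = (\<lambda>t. 1 / 2 * (\<Sum>k = 1..N. (\<Sum>r<m^2. (cmod (F k r (zs j)
          + complex_of_real t * (c * F k r (unit_vec (n^2) a))) - s k r)^2) / real (m^2)))"
      unfolding along_def obj
      by (intro ext arg_cong2[where f = "(*)"] arg_cong2[where f = "(/)"] sum.cong refl)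
        (simp add: line)
    moreover have "s k r = 0 \<or> F k r (zs j) \<noteq> 0" if "k \<in> {1..N}" "r < m^2" for k r
      using nz that by (auto simp: s_def F_def)
    ultimately show "along (objective m N Q P d) (zs j) a c field_differentiable at 0"
      by (simp only: divide_inverse)
        (intro field_differentiable_mult field_differentiable_sum
          modulus_misfit_line_differentiable field_differentiable_const; simp)
  qed

  show ?thesis
    using agree dominated sur_diff obj_diff
      complex_gradient_eq_of_touching[OF _ sur_diff zj agree dominated]
    by blast
qed

end
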